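(* The count of all absentee-voxels in $\mathbf S_\cup^{\mathbb Z}(r)$, i.e. $|\mathbf S^{\mathbb Z}(r)\setminus\mathbf S_\cup^{\mathbb Z}(r)|$, is $\Theta(r^3)$ as the integer $r\to\infty$.
   Context: Digital circle of integer radius $r\ge 0$: $\mathcal C^{\mathbb Z}(r)=\{(i,j)\in\mathbb Z^2: |\max(|i|,|j|)-\sqrt{r^2-\min(|i|,|j|)^2}|<\tfrac12\}$ (points for which the square root is not real are excluded). Digital disc: $\mathcal D^{\mathbb Z}(r)$ is the set of all $(i,j_c)\in\mathbb Z^2$ for which there is $(i_c,j_c)\in\mathcal C^{\mathbb Z}(r)$ with $i$ between $0$ and $i_c$ inclusive. The interior of $\mathcal C^{\mathbb Z}(r)$ is $\mathcal D^{\mathbb Z}(r)\setminus\mathcal C^{\mathbb Z}(r)$ and its exterior is $\mathbb Z^2\setminus\mathcal D^{\mathbb Z}(r)$. Coordinates in $\mathbb Z^3$ are $(x,y,z)$. For $c=(0,j,0)$ and an integer $i\ge0$, $\mathcal C^{\mathbb Z}(c,i)=\{(x,j,z):(x,z)\in\mathcal C^{\mathbb Z}(i)\}$, with interior and exterior taken within the plane $y=j$. The generatrix $\mathcal C_{1,2}^{\mathbb Z}(r)$ is the part of $\mathcal C^{\mathbb Z}(r)$ in the first quadrant $\{i\ge0,\ j\ge0\}$, regarded as a sequence ordered from $(0,r)$ to $(r,0)$. $\mathcal H_\cup^{\mathbb Z}(r)=\bigcup_{(i,j)\in\mathcal C_{1,2}^{\mathbb Z}(r)}\mathcal C^{\mathbb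 Z}((0,j,0),i)$. A voxel $p$ in the plane $y=j$ is an absentee of $\mathcal H_\cup^{\mathbb Z}(r)$ iff there are two consecutive points $(i,j)$, $(i-1,j')$, $j'\in\{j,j+1\}$, of the generatrix such that $p$ lies in the interior of $\mathcal C^{\mathbb Z}(c,i)$ and in the exterior of $\mathcal C^{\mathbb Z}(c,i-1)$, where $c=(0,j,0)$. The complete (hollow) sphere $\mathcal S^{\mathbb Z}(r)$ is the union of $\mathcal H_\cup^{\mathbb Z}(r)$, its absentees, and the reflections of all these voxels in the $zx$-plane. The complete solid sphere $\mathbf S^{\mathbb Z}(r)$ is the union of $\mathcal S^{\mathbb Z}(r)$ and all voxels lying inside $\mathcal S^{\mathbb Z}(r)$, where a voxel lies inside if it belongs to a bounded 6-connected component (voxels adjacent when they differ by $1$ in exactly one coordinate) of $\mathbb Z^3\setminus\mathcal S^{\mathbb Z}(r)$. Put $\mathbf S_\cup^{\mathbb Z}(r)=\bigcup_{r'=0}^{r}\mathcal S^{\mathbb Z}(r')$. The absentee-voxels in $\mathbf S_\cup^{\mathbb Z}(r)$ (solid sphere absentees) are the elements of $\mathbf S^{\mathbb Z}(r)\setminus\mathbf S_\cup^{\mathbb Z}(r)$. *)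

theory Defs
  imports Complex_Main "HOL-Library.Landau_Symbols"
begin

text \<open>Radii are integers; every radius that occurs below is nonnegative.\<close>

definition digital_circle :: "int \<Rightarrow> (int \<times> int) set" where
  "digital_circle r = {(i, j). (min \<bar>i\<bar> \<bar>j\<bar>)\<^sup>2 \<le> r\<^sup>2 \<and>
     \<bar>real_of_int (max \<bar>i\<bar> \<bar>j\<bar>) - sqrt (real_of_int (r\<^sup>2 - (min \<bar>i\<bar> \<bar>j\<bar>)\<^sup>2))\<bar> < 1 / 2}"

definition digital_disc :: "int \<Rightarrow> (int \<times> int) set" where
  "digital_disc r = {(i, jc). \<exists>ic. (ic, jc) \<in> digital_circle r \<and>
     (0 \<le> i \<and> i \<le> ic \<or> ic \<le> i \<and> i \<le> 0)}"

definition circle_interior :: "int \<Rightarrow> (int \<times> int) set" where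
  "circle_interior r = digital_disc r - digital_circle r"

definition circle_exterior :: "int \<Rightarrow> (int \<times> int) set" where
  "circle_exterior r = - digital_disc r"

definition generatrix :: "int \<Rightarrow> (int \<times> int) set" where
  "generatrix r = {(i, j) \<in> digital_circle r. 0 \<le> i \<and> 0 \<le> j}"

text \<open>The traversal order from \<open>(0, r)\<close> to \<open>(r, 0)\<close>: from left to right, and downwards
  among points with the same first coordinate.\<close>

definition precedes :: "int \<times> int \<Rightarrow> int \<times> int \<Rightarrow> bool" where
  "precedes p q \<longleftrightarrow> fst p < fst q \<or> fst p = fst q \<and> snd p > snd q"

definition consecutive :: "int \<Rightarrow> int \<times> int \<Rightarrow> int \<times> int \<Rightarrow> bool" where
  "consecutive r p q \<longleftrightarrow> p \<in> generatrix r \<and> q \<in> generatrix r \<and> precedes p q \<and>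
     \<not> (\<exists>s \<in> generatrix r. precedes p s \<and> precedes s q)"

type_synonym voxel = "int \<times> int \<times> int"

text \<open>A copy of a set of \<open>(x, z)\<close>-points in the plane \<open>y = j\<close>.\<close>

definition in_plane :: "int \<Rightarrow> (int \<times> int) set \<Rightarrow> voxel set" where
  "in_plane j A = {(x, y, z). y = j \<and> (x, z) \<in> A}"

definition hemisphere_union :: "int \<Rightarrow> voxel set" where
  "hemisphere_union r = (\<Union>(i, j) \<in> generatrix r. in_plane j (digital_circle i))"

definition sphere_absentees :: "int \<Rightarrow> voxel set" where
  "sphere_absentees r = {p. \<exists>i j j'. j' \<in> {j, j + 1} \<and> consecutive r (i - 1, j') (i, j) \<and>
     p \<in> in_plane j (circle_interior i) \<and> p \<in> in_plane j (circle_exterior (i - 1))}"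

definition reflect_zx :: "voxel \<Rightarrow> voxel" where
  "reflect_zx = (\<lambda>(x, y, z). (x, - y, z))"

definition hollow_sphere :: "int \<Rightarrow> voxel set" where
  "hollow_sphere r = (let H = hemisphere_union r \<union> sphere_absentees r in H \<union> reflect_zx ` H)"

definition adjacent6 :: "voxel \<Rightarrow> voxel \<Rightarrow> bool" where
  "adjacent6 = (\<lambda>(x, y, z) (x', y', z').
     \<bar>x - x'\<bar> = 1 \<and> y = y' \<and> z = z' \<or>
     x = x' \<and> \<bar>y - y'\<bar> = 1 \<and> z = z' \<or>
     x = x' \<and> y = y' \<and> \<bar>z - z'\<bar> = 1)"

text \<open>The 6-connected component of \<open>p\<close> in \<open>A\<close>, meaningful for \<open>p \<in> A\<close>.\<close>

definition component6 :: "voxel set \<Rightarrow> voxel \<Rightarrow> voxel set" where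
  "component6 A p = {q. (p, q) \<in> {(u, v). u \<in> A \<and> v \<in> A \<and> adjacent6 u v}\<^sup>*}"

definition bounded_voxels :: "voxel set \<Rightarrow> bool" where
  "bounded_voxels A \<longleftrightarrow> (\<exists>B. \<forall>(x, y, z) \<in> A. \<bar>x\<bar> \<le> B \<and> \<bar>y\<bar> \<le> B \<and> \<bar>z\<bar> \<le> B)"

definition inside_voxels :: "voxel set \<Rightarrow> voxel set" where
  "inside_voxels S = {p. p \<notin> S \<and> bounded_voxels (component6 (- S) p)}"

definition solid_sphere :: "int \<Rightarrow> voxel set" where
  "solid_sphere r = hollow_sphere r \<union> inside_voxels (hollow_sphere r)"

definition solid_sphere_union :: "int \<Rightarrow> voxel set" where
  "solid_sphere_union r = (\<Union>r' \<in> {0..r}. hollow_sphere r')"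

definition solid_sphere_absentees :: "int \<Rightarrow> voxel set" where
  "solid_sphere_absentees r = solid_sphere r - solid_sphere_union r"

end

theory Submission
  imports Defs
begin

text \<open>
  A point \<open>(i, j)\<close> with \<open>m = max \<bar>i\<bar> \<bar>j\<bar>\<close> lies on the circle of radius \<open>r > 0\<close> iff
  \<open>i\<^sup>2 + j\<^sup>2 - m < r\<^sup>2 \<le> i\<^sup>2 + j\<^sup>2 + m\<close>, and in the disc iff the first inequality holds.
  A voxel \<open>(x, y, z)\<close> for which \<open>(x, z)\<close> is on the circle of radius \<open>i > 0\<close> belongs to a hollow
  sphere only if \<open>(i, \<bar>y\<bar>)\<close> is on a circle. In each row \<open>n\<close> a positive proportion of the points
  \<open>(i, n)\<close>, \<open>n \<le> i \<le> 2 n\<close>, is on no circle, because the bounds above cut the row into disjoint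
  intervals and there are too few squares to hit them all. Each such point gives at least
  \<open>i + 1\<close> missing voxels, one for every \<open>z\<close> between \<open>0\<close> and \<open>i\<close>, hence cubically many in total.
  They are in the solid sphere because the hollow sphere, with its absentees filled in,
  6-separates the region it encloses. The upper bound is the volume of the bounding cube.
\<close>

section \<open>Integer bounds behind circle and disc membership\<close>

definition lower :: "int \<Rightarrow> int \<Rightarrow> int" where
  "lower i j = i\<^sup>2 + j\<^sup>2 - max \<bar>i\<bar> \<bar>j\<bar>"

definition upper :: "int \<Rightarrow> int \<Rightarrow> int" where
  "upper i j = i\<^sup>2 + j\<^sup>2 + max \<bar>i\<bar> \<bar>j\<bar>"

lemma lower_abs [simp]: "lower \<bar>i\<bar> j = lower i j" "lower i \<bar>j\<bar> = lower i j"
  by (simp_all add: lower_def)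

lemma lower_commute: "lower i j = lower j i"
  by (simp add: lower_def max.commute)

lemma upper_commute: "upper i j = upper j i"
  by (simp add: upper_def max.commute)

text \<open>While \<open>\<bar>i'\<bar> \<le> \<bar>j\<bar>\<close> the subtracted maximum is
  constant; beyond that it grows, but integers 0 <= a < c satisfy a^2 <= c (c - 1).\<close>

lemma lower_mono_left:
  assumes "\<bar>i\<bar> \<le> \<bar>i'\<bar>"
  shows "lower i j \<le> lower i' j"
proof -
  define a b c where abc: "a = \<bar>i\<bar>" "b = \<bar>j\<bar>" "c = \<bar>i'\<bar>"
  have nn: "0 \<le> a" "0 \<le> b" "a \<le> c"
    using assms by (auto simp: abc)
  have "a\<^sup>2 - max a b \<le> c\<^sup>2 - max c b"
  proof (cases "c \<le> b")
    case True
    then show ?thesis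
      using nn power_mono[of a c 2] by simp
  next
    case False
    show ?thesis
    proof (cases "a = c")
      case ne: False
      have "a * a \<le> c * (c - 1)"
        using nn ne by (intro mult_mono) auto
      then show ?thesis
        using False nn by (simp add: power2_eq_square algebra_simps)
    qed simp
  qed
  then show ?thesis
    by (simp add: lower_def abc)
qed

lemma lower_mono:
  assumes "\<bar>i\<bar> \<le> \<bar>i'\<bar>" "\<bar>j\<bar> \<le> \<bar>j'\<bar>"
  shows "lower i j \<le> lower i' j'"
  using lower_mono_left[OF assms(1), of j] lower_mono_left[OF assms(2), of i']
  by (simp add: lower_commute)

lemma upper_mono:
  assumes "\<bar>i\<bar> \<le> \<bar>i'\<bar>" "\<bar>j\<bar> \<le> \<bar>j'\<bar>"
  shows "upper i j \<le> upper i' j'"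
proof -
  have "i\<^sup>2 \<le> i'\<^sup>2" "j\<^sup>2 \<le> j'\<^sup>2"
    using assms by (simp_all add: abs_le_square_iff)
  then show ?thesis
    using max.mono[OF assms] unfolding upper_def by linarith
qed

text \<open>Reduces to 2 a + 1 <= max (a + 1) b + max a b for a = |i|, b = |j|. Thus a unit step
  outward leaves no gap between the intervals (\<open>lower\<close>, \<open>upper\<close>], the
  source of the separation properties below.\<close>

lemma lower_Suc_le_upper: "lower (\<bar>i\<bar> + 1) j \<le> upper i j"
  by (auto simp: lower_def upper_def power2_sum max_def)

lemma lower_step_le_upper:
  assumes "\<bar>i'\<bar> \<le> \<bar>i\<bar> + 1 \<and> j' = j \<or> i' = i \<and> \<bar>j'\<bar> \<le> \<bar>j\<bar> + 1"
  shows "lower i' j' \<le> upper i j"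
proof -
  have *: "lower a b \<le> upper c b" if "\<bar>a\<bar> \<le> \<bar>c\<bar> + 1" for a b c
    using lower_mono[of a "\<bar>c\<bar> + 1" b b] lower_Suc_le_upper[of c b] that by simp
  from assms show ?thesis
    using *[of i' i j] *[of j' j i] by (auto simp: lower_commute upper_commute)
qed

section \<open>Circles and discs as integer inequalities\<close>

text \<open>Squaring is monotone because m - 1/2 is positive. The 1/4 in (m +- 1/2)^2 disappears by
  integrality and makes the second bound weak.\<close>

lemma near_sqrt_iff:
  fixes m q :: int
  assumes "1 \<le> m" "0 \<le> q"
  shows "\<bar>real_of_int m - sqrt (real_of_int q)\<bar> < 1 / 2 \<longleftrightarrow> m\<^sup>2 - m < q \<and> q \<le> m\<^sup>2 + m"
proof -
  have sq: "(sqrt (real_of_int q))\<^sup>2 = real_of_int q" "0 \<le> sqrt (real_of_int q)"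
    using assms by auto
  have m1: "real_of_int m \<ge> 1"
    using assms by simp
  have "\<bar>real_of_int m - sqrt (real_of_int q)\<bar> < 1 / 2 \<longleftrightarrow>
      real_of_int m - 1 / 2 < sqrt (real_of_int q) \<and> sqrt (real_of_int q) < real_of_int m + 1 / 2"
    by linarith
  also have "\<dots> \<longleftrightarrow> (real_of_int m - 1 / 2)\<^sup>2 < real_of_int q \<and> real_of_int q < (real_of_int m + 1 / 2)\<^sup>2"
    using sq(2) m1 power_mono_iff[of "real_of_int m + 1 / 2" "sqrt (real_of_int q)" 2]
      power_mono_iff[of "sqrt (real_of_int q)" "real_of_int m - 1 / 2" 2]
    by (simp add: sq(1) flip: not_le)
  also have "\<dots> \<longleftrightarrow> real_of_int (m\<^sup>2 - m) + 1 / 4 < real_of_int q \<and> real_of_int q < real_of_int (m\<^sup>2 + m) + 1 / 4"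
    by (simp add: power2_eq_square algebra_simps)
  also have "\<dots> \<longleftrightarrow> m\<^sup>2 - m < q \<and> q \<le> m\<^sup>2 + m"
    by linarith
  finally show ?thesis .
qed

lemma circle_0: "(i, j) \<in> digital_circle 0 \<longleftrightarrow> i = 0 \<and> j = 0"
  by (auto simp: digital_circle_def min_def split: if_splits)

lemma circle_origin: "(0, 0) \<in> digital_circle r \<longleftrightarrow> r = 0"
  by (simp add: digital_circle_def) linarith

lemma circle_iff:
  assumes "1 \<le> r"
  shows "(i, j) \<in> digital_circle r \<longleftrightarrow> lower i j < r\<^sup>2 \<and> r\<^sup>2 \<le> upper i j"
proof (cases "i = 0 \<and> j = 0")
  case True
  then show ?thesis
    using assms by (simp add: circle_origin upper_def)
next
  case False
  define m n where mn: "m = max \<bar>i\<bar> \<bar>j\<bar>" "n = min \<bar>i\<bar> \<bar>j\<bar>"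
  have m: "1 \<le> m"
    using False by (auto simp: mn)
  have s: "i\<^sup>2 + j\<^sup>2 = m\<^sup>2 + n\<^sup>2"
    by (auto simp: mn max_def min_def)
  \<comment> \<open>With this, \<open>lower i j < r\<^sup>2\<close> implies n^2 < r^2, so the square
    root is real.\<close>
  have "m \<le> m\<^sup>2"
    using m by (simp add: self_le_power)
  then show ?thesis
    using near_sqrt_iff[OF m, of "r\<^sup>2 - n\<^sup>2"]
    by (auto simp: digital_circle_def lower_def upper_def s simp flip: mn)
qed

lemma circle_abs: "(\<bar>i\<bar>, \<bar>j\<bar>) \<in> digital_circle r \<longleftrightarrow> (i, j) \<in> digital_circle r"
  by (simp add: digital_circle_def)

text \<open>Moving outward along the row, the last point with \<open>lower\<close> below r^2 has
  \<open>upper\<close> at least r^2, as there is no gap. It is the circle point that the definition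
  of the disc asks for.\<close>

lemma disc_iff:
  assumes "1 \<le> r"
  shows "(i, j) \<in> digital_disc r \<longleftrightarrow> lower i j < r\<^sup>2"
proof
  assume "(i, j) \<in> digital_disc r"
  then obtain c where c: "(c, j) \<in> digital_circle r" "\<bar>i\<bar> \<le> \<bar>c\<bar>"
    unfolding digital_disc_def by auto
  then show "lower i j < r\<^sup>2"
    using lower_mono[OF c(2), of j j] by (simp add: circle_iff[OF assms])
next
  assume *: "lower i j < r\<^sup>2"
  define P where "P n \<longleftrightarrow> r\<^sup>2 \<le> lower (\<bar>i\<bar> + int n) j" for n
  \<comment> \<open>The search ends: after r + 1 steps \<open>lower\<close> is at least (r + 1)
    r.\<close>
  have "P (nat (r + 1))"
  proof -
    have "r * r \<le> (\<bar>i\<bar> + (r + 1)) * (\<bar>i\<bar> + (r + 1) - 1)"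
      using assms by (intro mult_mono) auto
    also have "\<dots> = lower (\<bar>i\<bar> + (r + 1)) 0"
      using assms by (simp add: lower_def power2_eq_square algebra_simps)
    also have "\<dots> \<le> lower (\<bar>i\<bar> + (r + 1)) j"
      by (intro lower_mono) auto
    finally show ?thesis
      using assms by (simp add: P_def power2_eq_square)
  qed
  then have n: "P (LEAST n. P n)"
    by (rule LeastI)
  moreover have "\<not> P 0"
    using * by (simp add: P_def)
  ultimately obtain k where k: "(LEAST n. P n) = Suc k"
    by (metis not0_implies_Suc)
  then have "\<not> P k"
    using not_less_Least[of k P] by simp
  then have 1: "lower (\<bar>i\<bar> + int k) j < r\<^sup>2"
    by (simp add: P_def)
  have "r\<^sup>2 \<le> lower (\<bar>\<bar>i\<bar> + int k\<bar> + 1) j"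
    using n unfolding k by (simp add: P_def add_ac)
  then have "r\<^sup>2 \<le> upper (\<bar>i\<bar> + int k) j"
    using lower_Suc_le_upper order.trans by blast
  with 1 have c: "(\<bar>i\<bar> + int k, j) \<in> digital_circle r"
    by (simp add: circle_iff[OF assms])
  show "(i, j) \<in> digital_disc r"
  proof (cases "0 \<le> i")
    case True
    then show ?thesis
      using c unfolding digital_disc_def by auto
  next
    case False
    have "(- (\<bar>i\<bar> + int k), j) \<in> digital_circle r"
      using c circle_abs[of "\<bar>i\<bar> + int k" j r]
      by (subst circle_abs[symmetric]) (simp add: add.commute)
    then show ?thesis
      using False unfolding digital_disc_def by fastforce
  qed
qed

lemma disc_0: "(i, j) \<in> digital_disc 0 \<longleftrightarrow> i = 0 \<and> j = 0"
  by (auto simp: digital_disc_def circle_0)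

lemma circle_subset_disc: "digital_circle r \<subseteq> digital_disc r"
proof clarify
  fix i j assume "(i, j) \<in> digital_circle r"
  then show "(i, j) \<in> digital_disc r"
    unfolding digital_disc_def by (cases "0 \<le> i") auto
qed

lemma disc_mono:
  assumes "(i, j) \<in> digital_disc r" "\<bar>i'\<bar> \<le> \<bar>i\<bar>" "\<bar>j'\<bar> \<le> \<bar>j\<bar>" "0 \<le> r" "r \<le> r'"
  shows "(i', j') \<in> digital_disc r'"
proof (cases "1 \<le> r")
  case True
  then have "lower i' j' < r\<^sup>2"
    using assms lower_mono[OF assms(2,3)] by (simp add: disc_iff)
  also have "\<dots> \<le> r'\<^sup>2"
    using assms True by (intro power_mono) auto
  finally show ?thesis
    using True assms by (simp add: disc_iff)
next
  case False
  then have "i' = 0" "j' = 0" "r = 0"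
    using assms disc_0[of i j] by (cases "r = 0"; auto)+
  then show ?thesis
    using assms by (cases "r' = 0") (auto simp: disc_iff disc_0 lower_def)
qed

lemma disc_le:
  assumes "(i, j) \<in> digital_disc r" "0 \<le> r"
  shows "\<bar>i\<bar> \<le> r \<and> \<bar>j\<bar> \<le> r"
proof (cases "1 \<le> r")
  case True
  define m where "m = max \<bar>i\<bar> \<bar>j\<bar>"
  have "m\<^sup>2 \<le> i\<^sup>2 + j\<^sup>2"
    by (auto simp: m_def max_def)
  then have "m * (m - 1) < r\<^sup>2"
    using assms True by (simp add: disc_iff lower_def m_def[symmetric] power2_eq_square algebra_simps)
  then have "m < r + 1"
    using mult_mono[of r m r "m - 1"] True assms(2) by (force simp: power2_eq_square)
  then show ?thesis
    by (simp add: m_def)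
next
  case False
  then show ?thesis
    using assms disc_0[of i j] by (cases "r = 0"; simp)
qed

lemma interior_iff:
  assumes "1 \<le> r"
  shows "(i, j) \<in> circle_interior r \<longleftrightarrow> upper i j < r\<^sup>2"
  using lower_step_le_upper[of i i j j]
  by (auto simp: circle_interior_def disc_iff[OF assms] circle_iff[OF assms])

lemma interior_pos:
  assumes "p \<in> circle_interior r" "0 \<le> r"
  shows "1 \<le> r"
  using assms by (cases "r = 0"; cases p) (auto simp: circle_interior_def disc_0 circle_0)

text \<open>An interior point has \<open>upper\<close> below r^2, so its neighbours have
  \<open>lower\<close> below r^2: the circle 4-separates interior from exterior.\<close>

lemma interior_step_disc:
  assumes "(i, j) \<in> circle_interior r" "0 \<le> r"
    "\<bar>i'\<bar> \<le> \<bar>i\<bar> + 1 \<and> j' = j \<or> i' = i \<and> \<bar>j'\<bar> \<le> \<bar>j\<bar> + 1"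
  shows "(i', j') \<in> digital_disc r"
  using assms interior_pos[OF assms(1,2)] lower_step_le_upper[OF assms(3)]
  by (simp add: interior_iff disc_iff)

text \<open>In the disc \<open>upper\<close> exceeds \<open>lower\<close> by at most 2 r, and r^2 +
  2 r < (r + 1)^2.\<close>

lemma disc_step_disc:
  assumes "(i, j) \<in> digital_disc r" "0 \<le> r"
    "\<bar>i'\<bar> \<le> \<bar>i\<bar> + 1 \<and> j' = j \<or> i' = i \<and> \<bar>j'\<bar> \<le> \<bar>j\<bar> + 1"
  shows "(i', j') \<in> digital_disc (r + 1)"
proof (cases "1 \<le> r")
  case True
  have "max \<bar>i\<bar> \<bar>j\<bar> \<le> r"
    using disc_le[OF assms(1,2)] by simp
  then have "upper i j \<le> lower i j + 2 * r"
    unfolding lower_def upper_def by linarith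
  also have "\<dots> < (r + 1)\<^sup>2"
    using assms True by (simp add: disc_iff power2_sum)
  finally show ?thesis
    using lower_step_le_upper[OF assms(3)] True by (simp add: disc_iff)
next
  case False
  then have "r = 0"
    using assms(2) by simp
  then show ?thesis
    using assms(1) lower_step_le_upper[OF assms(3)] by (simp add: disc_0 disc_iff upper_def)
qed

section \<open>Consecutive points of the generatrix\<close>

text \<open>Supplies the consecutive pair that an absentee requires. By \<open>top\<close>, (i, j)
  is the highest point of column i, so it directly follows the lowest generatrix point of column i -
  1.\<close>

lemma generatrix_predecessor:
  assumes ij: "(i, j) \<in> generatrix r" and i: "1 \<le> i" and r: "1 \<le> r"
    and top: "(i, j + 1) \<notin> digital_disc r"
  shows "\<exists>j' \<in> {j, j + 1}. consecutive r (i - 1, j') (i, j)"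
proof -
  have j: "0 \<le> j" and l: "lower i j < r\<^sup>2" and u: "r\<^sup>2 \<le> upper i j"
    using ij by (auto simp: generatrix_def circle_iff[OF r])
  have t: "r\<^sup>2 \<le> lower i (j + 1)"
    using top by (simp add: disc_iff[OF r])
  have above: "b \<le> j" if "(i, b) \<in> generatrix r" for b
  proof (rule ccontr)
    assume "\<not> b \<le> j"
    then have "lower i (j + 1) \<le> lower i b"
      using j by (intro lower_mono) auto
    then show False
      using that t by (auto simp: generatrix_def circle_iff[OF r])
  qed
  have below: "j \<le> b" if "(i - 1, b) \<in> generatrix r" for b
  proof (rule ccontr)
    assume b: "\<not> j \<le> b"
    have b0: "0 \<le> b"
      using that by (simp add: generatrix_def)
    have "upper (i - 1) b \<le> upper (i - 1) (j - 1)"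
      using b b0 i by (intro upper_mono) auto
    \<comment> \<open>As i and j are at least 1, 2 max i j + 1 <= 2 i + 2 j: the diagonal neighbour
      (i - 1, j - 1) is never on the same circle.\<close>
    also have "\<dots> \<le> lower i j"
      using i b b0 by (simp add: upper_def lower_def power2_diff max_def)
    finally show False
      using that l by (simp add: generatrix_def circle_iff[OF r])
  qed
  have consec: "consecutive r (i - 1, j') (i, j)"
    if j': "(i - 1, j') \<in> generatrix r" and least: "\<And>b. (i - 1, b) \<in> generatrix r \<Longrightarrow> j' \<le> b" for j'
    unfolding consecutive_def
  proof (intro conjI notI)
    assume "\<exists>s\<in>generatrix r. precedes (i - 1, j') s \<and> precedes s (i, j)"
    then obtain a b where s: "(a, b) \<in> generatrix r" "precedes (i - 1, j') (a, b)" "precedes (a, b) (i, j)"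
      by auto
    then have "a = i - 1 \<and> b < j' \<or> a = i \<and> j < b"
      by (auto simp: precedes_def)
    then show False
      using s(1) least above by fastforce
  qed (use ij j' in \<open>auto simp: precedes_def\<close>)
  show ?thesis
  proof (cases "(i - 1, j) \<in> generatrix r")
    case True
    then show ?thesis
      using consec below by blast
  next
    case False
    \<comment> \<open>Now (i - 1, j) is interior; the point above it is still in the disc, and
      \<open>top\<close> keeps that point from being interior.\<close>
    have "lower (i - 1) j \<le> lower i j"
      using i by (intro lower_mono) auto
    then have "upper (i - 1) j < r\<^sup>2"
      using False l i j by (auto simp: generatrix_def circle_iff[OF r])
    then have "lower (i - 1) (j + 1) < r\<^sup>2"
      using lower_step_le_upper[of "i - 1" "i - 1" "j + 1" j] j by simp
    moreover have "lower i (j + 1) \<le> upper (i - 1) (j + 1)"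
      using i by (intro lower_step_le_upper) auto
    ultimately have "(i - 1, j + 1) \<in> generatrix r"
      using t i j by (simp add: generatrix_def circle_iff[OF r])
    moreover have "j + 1 \<le> b" if "(i - 1, b) \<in> generatrix r" for b
      using below[OF that] that False by (cases "b = j") auto
    ultimately show ?thesis
      using consec by blast
  qed
qed

section \<open>The region enclosed by a hollow sphere\<close>

lemma hollow_sphere_iff:
  "(x, y, z) \<in> hollow_sphere r \<longleftrightarrow> (x, \<bar>y\<bar>, z) \<in> hemisphere_union r \<union> sphere_absentees r"
proof -
  define H where "H = hemisphere_union r \<union> sphere_absentees r"
  have "0 \<le> y" if "(x, y, z) \<in> H" for x y z
    using that unfolding H_def hemisphere_union_def sphere_absentees_def in_plane_def consecutive_def generatrix_def
    by auto
  moreover have "(x, y, z) \<in> reflect_zx ` H \<longleftrightarrow> (x, - y, z) \<in> H"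
    by (force simp: reflect_zx_def image_iff)
  ultimately show ?thesis
    unfolding hollow_sphere_def Let_def H_def[symmetric]
    by (smt (verit) Un_iff)
qed

text \<open>The disc revolved about the y-axis, used as an invariant of walks that avoid the hollow
  sphere.\<close>

definition ball_region :: "int \<Rightarrow> voxel set" where
  "ball_region r = {(x, y, z). \<exists>k \<ge> 0. (k, y) \<in> digital_disc r \<and> (x, z) \<in> digital_disc k}"

text \<open>Take the least k whose disc contains (x, z). If (k, y) is interior, there is room to
  raise k by one or to change y. If it is on the circle, (x, z) is interior to circle k, and only a
  step in y could leave the region. That needs column k to end at |y|, which would make p an
  absentee and so a voxel of the sphere.\<close>

lemma ball_region_step:
  assumes r: "1 \<le> r" and p: "p \<in> ball_region r" "p \<notin> hollow_sphere r" and adj: "adjacent6 p q"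
  shows "q \<in> ball_region r"
proof -
  obtain x y z where p_eq: "p = (x, y, z)" by (cases p)
  obtain x' y' z' where q_eq: "q = (x', y', z')" by (cases q)
  define K where "K n \<longleftrightarrow> (int n, y) \<in> digital_disc r \<and> (x, z) \<in> digital_disc (int n)" for n
  have "\<exists>n. K n"
    using p unfolding p_eq ball_region_def K_def by (auto dest!: zero_le_imp_eq_int)
  \<comment> \<open>Minimality puts (x, z) outside disc k - 1 when k >= 1, the exterior condition of
    an absentee.\<close>
  define n where "n = (LEAST n. K n)"
  have Kn: "K n"
    unfolding n_def using \<open>\<exists>n. K n\<close> by (rule LeastI_ex)
  define k where "k = int n"
  have k0: "0 \<le> k" and ky: "(k, y) \<in> digital_disc r" and xz: "(x, z) \<in> digital_disc k"
    using Kn by (auto simp: K_def k_def)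
  have below: "(x, z) \<notin> digital_disc (k - 1)" if "1 \<le> k"
  proof
    assume *: "(x, z) \<in> digital_disc (k - 1)"
    have "(k - 1, y) \<in> digital_disc r"
      using ky that r by (auto intro: disc_mono)
    with * have "K (n - 1)"
      using that by (simp add: K_def k_def of_nat_diff)
    then show False
      using not_less_Least[of "n - 1" K] that by (simp add: n_def[symmetric] k_def)
  qed
  have inI: "q \<in> ball_region r" if "0 \<le> k'" "(k', y') \<in> digital_disc r" "(x', z') \<in> digital_disc k'" for k'
    using that unfolding q_eq ball_region_def by auto
  have adj': "y' = y \<and> (\<bar>x'\<bar> \<le> \<bar>x\<bar> + 1 \<and> z' = z \<or> x' = x \<and> \<bar>z'\<bar> \<le> \<bar>z\<bar> + 1) \<or>
      x' = x \<and> z' = z \<and> \<bar>y'\<bar> \<le> \<bar>y\<bar> + 1"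
    using adj unfolding p_eq q_eq adjacent6_def by auto
  show ?thesis
  proof (cases "(k, y) \<in> digital_circle r")
    case False
    then have int: "(k, y) \<in> circle_interior r"
      using ky by (simp add: circle_interior_def)
    from adj' show ?thesis
    proof
      assume a: "y' = y \<and> (\<bar>x'\<bar> \<le> \<bar>x\<bar> + 1 \<and> z' = z \<or> x' = x \<and> \<bar>z'\<bar> \<le> \<bar>z\<bar> + 1)"
      show ?thesis
      proof (rule inI[of "k + 1"])
        show "(k + 1, y') \<in> digital_disc r"
          using int r k0 a by (intro interior_step_disc[OF int]) auto
        show "(x', z') \<in> digital_disc (k + 1)"
          using a k0 by (intro disc_step_disc[OF xz]) auto
      qed (use k0 in simp)
    next
      assume a: "x' = x \<and> z' = z \<and> \<bar>y'\<bar> \<le> \<bar>y\<bar> + 1"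
      then have "(k, y') \<in> digital_disc r"
        using r by (intro interior_step_disc[OF int]) auto
      then show ?thesis
        using a xz k0 by (intro inI[of k]) auto
    qed
  next
    case True
    then have gen: "(k, \<bar>y\<bar>) \<in> generatrix r"
      using circle_abs[of k y r] k0 by (simp add: generatrix_def)
    have "(x, z) \<notin> digital_circle k"
      using p(2) gen unfolding p_eq hollow_sphere_iff by (auto simp: hemisphere_union_def in_plane_def)
    then have int: "(x, z) \<in> circle_interior k"
      using xz by (simp add: circle_interior_def)
    have k1: "1 \<le> k"
      using interior_pos[OF int k0] .
    from adj' show ?thesis
    proof
      assume a: "y' = y \<and> (\<bar>x'\<bar> \<le> \<bar>x\<bar> + 1 \<and> z' = z \<or> x' = x \<and> \<bar>z'\<bar> \<le> \<bar>z\<bar> + 1)"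
      then have "(x', z') \<in> digital_disc k"
        using k0 by (intro interior_step_disc[OF int]) auto
      then show ?thesis
        using a ky k0 by (intro inI[of k]) auto
    next
      assume a: "x' = x \<and> z' = z \<and> \<bar>y'\<bar> \<le> \<bar>y\<bar> + 1"
      have "(k, \<bar>y\<bar> + 1) \<in> digital_disc r"
      proof (rule ccontr)
        assume "\<not> ?thesis"
        then obtain j' where "j' \<in> {\<bar>y\<bar>, \<bar>y\<bar> + 1}" "consecutive r (k - 1, j') (k, \<bar>y\<bar>)"
          using generatrix_predecessor[OF gen k1 r] by blast
        then have "(x, \<bar>y\<bar>, z) \<in> sphere_absentees r"
          unfolding sphere_absentees_def using int below[OF k1]
          by (fastforce simp: in_plane_def circle_exterior_def)
        then show False
          using p(2) by (simp add: p_eq hollow_sphere_iff)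
      qed
      then have "(k, y') \<in> digital_disc r"
        using a r by (auto intro: disc_mono)
      then show ?thesis
        using a xz k0 by (intro inI[of k]) auto
    qed
  qed
qed

lemma ball_region_bounded:
  assumes "(x, y, z) \<in> ball_region r" "0 \<le> r"
  shows "\<bar>x\<bar> \<le> r \<and> \<bar>y\<bar> \<le> r \<and> \<bar>z\<bar> \<le> r"
proof -
  obtain k where k: "0 \<le> k" "(k, y) \<in> digital_disc r" "(x, z) \<in> digital_disc k"
    using assms(1) by (auto simp: ball_region_def)
  show ?thesis
    using disc_le[OF k(2) assms(2)] disc_le[OF k(3,1)] by linarith
qed

text \<open>By \<open>ball_region_step\<close>, a component of the complement that starts in the
  region stays in it and is bounded.\<close>

lemma ball_region_subset_solid_sphere:
  assumes "1 \<le> r"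
  shows "ball_region r \<subseteq> solid_sphere r"
proof
  fix p assume p: "p \<in> ball_region r"
  show "p \<in> solid_sphere r"
  proof (cases "p \<in> hollow_sphere r")
    case False
    have "q \<in> ball_region r \<and> q \<notin> hollow_sphere r" if "q \<in> component6 (- hollow_sphere r) p" for q
    proof -
      from that have "(p, q) \<in> {(u, v). u \<in> - hollow_sphere r \<and> v \<in> - hollow_sphere r \<and> adjacent6 u v}\<^sup>*"
        by (simp add: component6_def)
      then show ?thesis
        by (induction rule: rtrancl_induct) (use p False ball_region_step[OF assms] in auto)
    qed
    then have "bounded_voxels (component6 (- hollow_sphere r) p)"
      unfolding bounded_voxels_def using ball_region_bounded assms
      by (intro exI[of _ r]) fastforce
    then show ?thesis
      using False by (simp add: solid_sphere_def inside_voxels_def)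
  qed (simp add: solid_sphere_def)
qed

section \<open>The cubic upper bound\<close>

lemma hollow_sphere_bounded:
  assumes "(x, y, z) \<in> hollow_sphere r" "0 \<le> r"
  shows "\<bar>x\<bar> \<le> r \<and> \<bar>y\<bar> \<le> r \<and> \<bar>z\<bar> \<le> r"
proof -
  have "\<exists>i j. (i, j) \<in> generatrix r \<and> \<bar>y\<bar> = j \<and> (x, z) \<in> digital_disc i"
    using assms(1) circle_subset_disc
    by (auto simp: hollow_sphere_iff hemisphere_union_def sphere_absentees_def in_plane_def
        consecutive_def circle_interior_def)
  then obtain i where i: "(i, \<bar>y\<bar>) \<in> generatrix r" "(x, z) \<in> digital_disc i"
    by blast
  then have "0 \<le> i" "(i, \<bar>y\<bar>) \<in> digital_disc r"
    using circle_subset_disc by (auto simp: generatrix_def)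
  then show ?thesis
    using disc_le[of x z i] disc_le[of i "\<bar>y\<bar>" r] i(2) assms(2) by auto
qed

text \<open>All points of the path lie in the component of its start, which is therefore
  unbounded.\<close>

lemma escaping_path_not_inside:
  assumes path: "\<And>n. f n \<notin> S" "\<And>n. adjacent6 (f n) (f (Suc n))"
    and unbounded: "\<And>B. \<exists>n x y z. f n = (x, y, z) \<and> (B < \<bar>x\<bar> \<or> B < \<bar>y\<bar> \<or> B < \<bar>z\<bar>)"
  shows "f 0 \<notin> inside_voxels S"
proof
  assume "f 0 \<in> inside_voxels S"
  then obtain B where B: "\<forall>(x, y, z) \<in> component6 (- S) (f 0). \<bar>x\<bar> \<le> B \<and> \<bar>y\<bar> \<le> B \<and> \<bar>z\<bar> \<le> B"
    by (auto simp: inside_voxels_def bounded_voxels_def)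
  have "f n \<in> component6 (- S) (f 0)" for n
  proof (induction n)
    case (Suc n)
    then show ?case
      using path by (auto simp: component6_def intro: rtrancl_into_rtrancl)
  qed (simp add: component6_def)
  moreover obtain n x y z where "f n = (x, y, z)" "B < \<bar>x\<bar> \<or> B < \<bar>y\<bar> \<or> B < \<bar>z\<bar>"
    using unbounded by blast
  ultimately show False
    using B by (metis (no_types, lifting) case_prodD not_le)
qed

lemma inside_voxels_bounded:
  assumes inside: "(x, y, z) \<in> inside_voxels S"
    and S: "\<And>x y z. (x, y, z) \<in> S \<Longrightarrow> \<bar>x\<bar> \<le> r \<and> \<bar>y\<bar> \<le> r \<and> \<bar>z\<bar> \<le> r"
  shows "\<bar>x\<bar> \<le> r \<and> \<bar>y\<bar> \<le> r \<and> \<bar>z\<bar> \<le> r"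
proof (rule ccontr)
  \<comment> \<open>Walking away from 0 along a coordinate beyond r never meets the cube that
    contains S.\<close>
  define away where "away a n = (if 0 \<le> a then a + int n else a - int n)" for a n
  have away: "\<bar>away a n\<bar> = \<bar>a\<bar> + int n" "away a 0 = a" "\<bar>away a n - away a (Suc n)\<bar> = 1" for a n
    by (auto simp: away_def)
  have far: "\<exists>n. B < \<bar>a\<bar> + int n" for a B
    by (intro exI[of _ "nat \<bar>B\<bar> + 1"]) auto
  assume "\<not> ?thesis"
  then consider "r < \<bar>x\<bar>" | "r < \<bar>y\<bar>" | "r < \<bar>z\<bar>"
    by linarith
  then show False
  proof cases
    case 1
    have "(\<lambda>n. (away x n, y, z)) 0 \<notin> inside_voxels S"
      using 1 S[of "away x n" y z for n] far[of _ x]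
      by (intro escaping_path_not_inside) (force simp: adjacent6_def away)+
    then show ?thesis
      using inside by (simp add: away)
  next
    case 2
    have "(\<lambda>n. (x, away y n, z)) 0 \<notin> inside_voxels S"
      using 2 S[of x "away y n" z for n] far[of _ y]
      by (intro escaping_path_not_inside) (force simp: adjacent6_def away)+
    then show ?thesis
      using inside by (simp add: away)
  next
    case 3
    have "(\<lambda>n. (x, y, away z n)) 0 \<notin> inside_voxels S"
      using 3 S[of x y "away z n" for n] far[of _ z]
      by (intro escaping_path_not_inside) (force simp: adjacent6_def away)+
    then show ?thesis
      using inside by (simp add: away)
  qed
qed

lemma solid_sphere_absentees_subset:
  assumes "0 \<le> r"
  shows "solid_sphere_absentees r \<subseteq> {- r..r} \<times> {- r..r} \<times> {- r..r}"
proof clarify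
  fix x y z assume "(x, y, z) \<in> solid_sphere_absentees r"
  then have "(x, y, z) \<in> hollow_sphere r \<or> (x, y, z) \<in> inside_voxels (hollow_sphere r)"
    by (auto simp: solid_sphere_absentees_def solid_sphere_def)
  then have "\<bar>x\<bar> \<le> r \<and> \<bar>y\<bar> \<le> r \<and> \<bar>z\<bar> \<le> r"
    using hollow_sphere_bounded[OF _ assms] inside_voxels_bounded[of x y z "hollow_sphere r" r] by blast
  then show "x \<in> {- r..r} \<and> (y, z) \<in> {- r..r} \<times> {- r..r}"
    by auto
qed

lemma card_solid_sphere_absentees_le:
  assumes "0 \<le> r"
  shows "int (card (solid_sphere_absentees r)) \<le> (2 * r + 1) ^ 3"
proof -
  have "card (solid_sphere_absentees r) \<le> card ({- r..r} \<times> {- r..r} \<times> {- r..r})"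
    using solid_sphere_absentees_subset[OF assms] by (intro card_mono) auto
  also have "\<dots> = nat (2 * r + 1) ^ 3"
    by (simp add: card_cartesian_product power3_eq_cube algebra_simps)
  finally have "int (card (solid_sphere_absentees r)) \<le> int (nat (2 * r + 1) ^ 3)"
    by linarith
  then show ?thesis
    using assms by simp
qed

section \<open>Voxels missed by all hollow spheres\<close>

definition uncovered :: "int \<Rightarrow> int \<Rightarrow> bool" where
  "uncovered i j \<longleftrightarrow> (\<forall>t. (i, j) \<notin> digital_circle t)"

text \<open>On circle a the maximum is at most a, so \<open>upper\<close> stays below a^2 + 2 a and
  cannot reach the next square.\<close>

lemma circle_unique:
  assumes "p \<in> digital_circle i" "p \<in> digital_circle i'" "1 \<le> i" "1 \<le> i'"
  shows "i = i'"
proof -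
  have *: False if p: "p \<in> digital_circle a" "p \<in> digital_circle b" and ab: "1 \<le> a" "a < b" for a b
  proof -
    obtain u v where uv: "p = (u, v)" by (cases p)
    have m: "max \<bar>u\<bar> \<bar>v\<bar> \<le> a"
      using disc_le[of u v a] p(1) circle_subset_disc[of a] ab by (auto simp: uv)
    have l: "lower u v < a\<^sup>2"
      using p(1) ab by (simp add: uv circle_iff)
    have "upper u v = lower u v + 2 * max \<bar>u\<bar> \<bar>v\<bar>"
      by (simp add: upper_def lower_def)
    also have "\<dots> < a\<^sup>2 + 2 * a"
      using l m by linarith
    also have "\<dots> < (a + 1)\<^sup>2"
      by (simp add: power2_sum)
    also have "\<dots> \<le> b\<^sup>2"
      using ab by (intro power_mono) auto
    also have "\<dots> \<le> upper u v"
      using p(2) ab by (simp add: uv circle_iff)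
    finally show False
      by simp
  qed
  show ?thesis
    using *[of i i'] *[of i' i] assms by (cases i i' rule: linorder_cases) auto
qed

text \<open>A circle voxel would have radius i by uniqueness, against \<open>uncovered\<close>. For
  an absentee, being interior to circle i' forces i < i'; then disc i lies within disc i' - 1,
  against its exterior condition.\<close>

lemma uncovered_not_in_hollow_sphere:
  assumes "uncovered i \<bar>y\<bar>" "(x, z) \<in> digital_circle i" "1 \<le> i"
  shows "(x, y, z) \<notin> hollow_sphere r"
proof
  assume "(x, y, z) \<in> hollow_sphere r"
  then consider "(x, \<bar>y\<bar>, z) \<in> hemisphere_union r" | "(x, \<bar>y\<bar>, z) \<in> sphere_absentees r"
    by (auto simp: hollow_sphere_iff)
  then consider (circle) i' where "(i', \<bar>y\<bar>) \<in> generatrix r" "(x, z) \<in> digital_circle i'"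
    | (absentee) i' j' where "(i' - 1, j') \<in> generatrix r" "(x, z) \<in> circle_interior i'" "(x, z) \<notin> digital_disc (i' - 1)"
  proof cases
    case 1
    then show ?thesis
      using that(1) by (auto simp: hemisphere_union_def in_plane_def)
  next
    case 2
    then obtain i' j j' where "consecutive r (i' - 1, j') (i', j)"
      "(x, z) \<in> circle_interior i'" "(x, z) \<in> circle_exterior (i' - 1)"
      unfolding sphere_absentees_def in_plane_def by blast
    then show ?thesis
      by (intro that(2)[of i' j']) (simp_all add: consecutive_def circle_exterior_def)
  qed
  then show False
  proof cases
    case circle
    then have "i' \<noteq> i" "0 \<le> i'"
      using assms(1) by (auto simp: generatrix_def uncovered_def)
    moreover have "i' \<noteq> 0"
    proof
      assume "i' = 0"
      then have "x = 0" "z = 0"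
        using circle(2) by (simp_all add: circle_0)
      then show False
        using assms(2,3) by (simp add: circle_origin)
    qed
    ultimately show ?thesis
      using circle_unique[OF circle(2) assms(2)] assms(3) by simp
  next
    case absentee
    then have i': "1 \<le> i'"
      by (simp add: generatrix_def)
    have "i < i'"
    proof (rule ccontr)
      assume "\<not> i < i'"
      then have "i'\<^sup>2 \<le> i\<^sup>2"
        using i' by (intro power_mono) linarith+
      then show False
        using absentee(2) assms(2) i' assms(3) by (simp add: interior_iff circle_iff del: power_mono_iff)
    qed
    moreover have "(x, z) \<in> digital_disc i"
      using assms(2) circle_subset_disc by blast
    ultimately have "(x, z) \<in> digital_disc (i' - 1)"
      using assms(3) by (intro disc_mono[of x z i x z "i' - 1"]) simp_all
    then show ?thesis
      using absentee(3) by simp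
  qed
qed

section \<open>Counting the missed voxels\<close>

text \<open>The disc contains (0, z), and each disc point comes with a circle point in its
  row.\<close>

lemma circle_point_in_row:
  assumes "0 \<le> z" "z \<le> i" "1 \<le> i"
  shows "\<exists>x. (x, z) \<in> digital_circle i"
proof -
  have "z * z \<le> i * i"
    using assms by (intro mult_mono) auto
  then have "lower 0 z < i\<^sup>2"
    using assms by (cases "z = 0") (auto simp: lower_def power2_eq_square)
  then have "(0, z) \<in> digital_disc i"
    using assms by (simp add: disc_iff)
  then show ?thesis
    by (auto simp: digital_disc_def)
qed

text \<open>For fixed \<open>n > 0\<close> the intervals \<open>(lower m n, upper m n]\<close>, \<open>m \<ge> n\<close>, are disjoint, so each of
  the roughly \<open>(sqrt 5 - sqrt 2) n\<close> squares between \<open>2 n\<^sup>2\<close> and \<open>5 n\<^sup>2\<close> covers at most one \<open>m\<close>.\<close>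

lemma card_uncovered_ge:
  assumes n: "31 \<le> n"
  shows "n \<le> 10 * int (card {m \<in> {n..2 * n}. uncovered m n})"
proof -
  define Cov where "Cov = {m \<in> {n..2 * n}. \<exists>t \<ge> 1. (m, n) \<in> digital_circle t}"
  define U where "U = {m \<in> {n..2 * n}. uncovered m n}"
  \<comment> \<open>As 7/5 < sqrt 2 and sqrt 5 < 9/4, this contains all possible radii; its length
    is about 17 n / 20.\<close>
  define T where "T = {7 * n div 5..(9 * n + 3) div 4}"
  have "{n..2 * n} \<subseteq> Cov \<union> U"
  proof
    fix m assume m: "m \<in> {n..2 * n}"
    show "m \<in> Cov \<union> U"
    proof (cases "uncovered m n")
      case False
      then obtain t where t: "(m, n) \<in> digital_circle t"
        by (auto simp: uncovered_def)
      then have "(m, n) \<in> digital_circle \<bar>t\<bar>"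
        by (simp add: digital_circle_def)
      moreover have "t \<noteq> 0"
        using t n circle_0[of m n] by auto
      ultimately show ?thesis
        using m by (auto simp: Cov_def intro!: exI[of _ "\<bar>t\<bar>"])
    qed (use m in \<open>simp add: U_def\<close>)
  qed
  moreover have "finite Cov" "finite U"
    unfolding Cov_def U_def by (rule finite_subset[of _ "{n..2 * n}"]; auto)+
  ultimately have "card {n..2 * n} \<le> card (Cov \<union> U)"
    by (intro card_mono) auto
  also have "\<dots> \<le> card Cov + card U"
    by (rule card_Un_le)
  finally have 1: "n + 1 \<le> int (card Cov) + int (card U)"
    using n by simp
  have "\<forall>m \<in> Cov. \<exists>t \<ge> 1. (m, n) \<in> digital_circle t"
    by (simp add: Cov_def)
  then obtain t where t: "\<And>m. m \<in> Cov \<Longrightarrow> 1 \<le> t m \<and> (m, n) \<in> digital_circle (t m)"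
    by metis
  have "card Cov \<le> card T"
  proof (rule card_inj_on_le)
    show "t ` Cov \<subseteq> T"
    proof clarify
      fix m assume m: "m \<in> Cov"
      have m2: "n \<le> m" "m \<le> 2 * n"
        using m by (auto simp: Cov_def)
      have t1: "1 \<le> t m" and c: "lower m n < (t m)\<^sup>2" "(t m)\<^sup>2 \<le> upper m n"
        using t[OF m] by (auto simp: circle_iff)
      have "lower n n \<le> lower m n" "upper m n \<le> upper (2 * n) n"
        using m2 n by (auto intro!: lower_mono upper_mono)
      then have sq: "2 * n\<^sup>2 - n < (t m)\<^sup>2" "(t m)\<^sup>2 \<le> 5 * n\<^sup>2 + 2 * n"
        using c n by (simp_all add: lower_def upper_def power_mult_distrib)
      \<comment> \<open>For integers, exceeding 7 n / 5 - 1 already gives the lower end of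
        \<open>T\<close>; the upper end is similar.\<close>
      have "7 * n - 5 < 5 * t m"
      proof (rule ccontr)
        assume "\<not> ?thesis"
        then have "(5 * t m)\<^sup>2 \<le> (7 * n - 5)\<^sup>2"
          using t1 by (intro power_mono) auto
        then have "25 * (t m)\<^sup>2 \<le> 49 * n\<^sup>2 - 70 * n + 25"
          by (simp add: power2_diff power_mult_distrib)
        then show False
          using sq(1) n zero_le_power2[of n] by linarith
      qed
      moreover have "4 * t m < 9 * n + 4"
      proof (rule ccontr)
        assume "\<not> ?thesis"
        then have "(9 * n + 4)\<^sup>2 \<le> (4 * t m)\<^sup>2"
          using n by (intro power_mono) auto
        then have "81 * n\<^sup>2 + 72 * n + 16 \<le> 16 * (t m)\<^sup>2"
          by (simp add: power2_sum power_mult_distrib)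
        then show False
          using sq(2) n zero_le_power2[of n] by linarith
      qed
      ultimately show "t m \<in> T"
        unfolding T_def by simp linarith
    qed
    have *: "t m < t m'" if "m \<in> Cov" "m' \<in> Cov" "m < m'" for m m'
    proof -
      have m: "n \<le> m"
        using that by (auto simp: Cov_def)
      have "(t m)\<^sup>2 \<le> upper m n"
        using t[OF that(1)] by (auto simp: circle_iff)
      \<comment> \<open>For m >= n both maxima are the first coordinate, so adjacent intervals meet
        end to end.\<close>
      also have "\<dots> = lower (m + 1) n"
        using m n by (simp add: upper_def lower_def power2_sum)
      also have "\<dots> \<le> lower m' n"
        using m n that by (intro lower_mono) auto
      also have "\<dots> < (t m')\<^sup>2"
        using t[OF that(2)] by (auto simp: circle_iff)
      finally show ?thesis
        using t[OF that(2)] by (auto intro: power2_less_imp_less)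
    qed
    then have "strict_mono_on Cov t"
      by (intro strict_mono_onI)
    then show "inj_on t Cov"
      by (rule strict_mono_on_imp_inj_on)
  qed (simp add: T_def)
  \<comment> \<open>Rounding and counting both ends add at most 4/5 + 3/4 + 1 = 51/20. Of n + 1
    points at least (3 n - 31) / 20 stay uncovered, which is at least n / 10 once n >= 31.\<close>
  moreover have "20 * int (card T) \<le> 17 * n + 51"
    unfolding T_def using n by simp
  ultimately have "20 * int (card Cov) \<le> 17 * n + 51"
    by linarith
  with 1 show ?thesis
    using n unfolding U_def by linarith
qed

text \<open>Each of the N + 1 rows n has at least N / 10 uncovered m, and each pair (n, m) yields N
  + 1 absentees, one for each z in \<open>{0..N}\<close>.\<close>

lemma card_solid_sphere_absentees_ge:
  assumes N: "31 \<le> N" "5 * N \<le> r"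
  shows "N ^ 3 \<le> 10 * int (card (solid_sphere_absentees r))"
proof -
  define U where "U n = {m \<in> {n..2 * n}. uncovered m n}" for n
  define T where "T = (SIGMA n : {N..2 * N}. U n \<times> {0..N})"
  have "\<forall>m z. N \<le> m \<and> 0 \<le> z \<and> z \<le> N \<longrightarrow> (\<exists>x. (x, z) \<in> digital_circle m)"
    using circle_point_in_row N by force
  then obtain X where X: "\<And>m z. N \<le> m \<Longrightarrow> 0 \<le> z \<Longrightarrow> z \<le> N \<Longrightarrow> (X m z, z) \<in> digital_circle m"
    by metis
  define f where "f = (\<lambda>(n :: int, m, z). (X m z, n, z))"
  have "N ^ 3 \<le> (\<Sum>n\<in>{N..2 * N}. N * (N + 1))"
    using N by (simp add: power3_eq_cube algebra_simps)
  also have "\<dots> \<le> (\<Sum>n\<in>{N..2 * N}. 10 * int (card (U n)) * (N + 1))"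
  proof (rule sum_mono)
    fix n assume n: "n \<in> {N..2 * N}"
    then have "N \<le> 10 * int (card (U n))"
      using card_uncovered_ge[of n] N by (simp add: U_def)
    then show "N * (N + 1) \<le> 10 * int (card (U n)) * (N + 1)"
      using N by (intro mult_right_mono) auto
  qed
  also have "\<dots> = 10 * int (card T)"
  proof -
    have "finite (U n)" for n
      unfolding U_def by (rule finite_subset[of _ "{n..2 * n}"]) auto
    then show ?thesis
      using N by (simp add: T_def card_SigmaI card_cartesian_product sum_distrib_left mult_ac)
  qed
  finally have "N ^ 3 \<le> 10 * int (card T)" .
  moreover have "card T \<le> card (solid_sphere_absentees r)"
  proof (rule card_inj_on_le)
    \<comment> \<open>The voxel shows n and z, and m is the radius of the unique circle through (X m
      z, z).\<close>
    show "inj_on f T"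
    proof (rule inj_onI)
      fix p q assume pq: "p \<in> T" "q \<in> T" "f p = f q"
      obtain n m z n' m' z' where p: "p = (n, m, z)" and q: "q = (n', m', z')"
        by (cases p; cases q) auto
      have a: "(n, m, z) \<in> T" "(n', m', z') \<in> T" "f (n, m, z) = f (n', m', z')"
        using pq p q by auto
      then have e: "n = n'" "z = z'" "X m z = X m' z'"
        by (auto simp: f_def)
      have "N \<le> m" "N \<le> m'" "0 \<le> z" "z \<le> N" "0 \<le> z'" "z' \<le> N"
        using a(1,2) by (auto simp: T_def U_def)
      then have "(X m z, z) \<in> digital_circle m" "(X m' z', z') \<in> digital_circle m'" "1 \<le> m" "1 \<le> m'"
        using X[of m z] X[of m' z'] N by simp_all
      then show "p = q"
        using e circle_unique p q by metis
    qed
    show "f ` T \<subseteq> solid_sphere_absentees r"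
    proof (rule image_subsetI)
      fix p assume "p \<in> T"
      moreover obtain n m z where p: "p = (n, m, z)"
        by (rule prod_cases3)
      ultimately have b: "N \<le> n" "n \<le> 2 * N" "n \<le> m" "m \<le> 4 * N" "uncovered m n" "0 \<le> z" "z \<le> N"
        by (auto simp: T_def U_def)
      have c: "(X m z, z) \<in> digital_circle m"
        using X[of m z] b by simp
      \<comment> \<open>The extreme pair (4 N, 2 N) has squared norm 20 N^2 < (5 N)^2, whence the
        condition 5 N <= r.\<close>
      have "lower m n \<le> lower (4 * N) (2 * N)"
        using b N by (intro lower_mono) auto
      also have "\<dots> < (5 * N)\<^sup>2"
      proof -
        have "lower (4 * N) (2 * N) = 20 * N\<^sup>2 - 4 * N" "(5 * N)\<^sup>2 = 25 * N\<^sup>2"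
          using N by (simp_all add: lower_def power_mult_distrib)
        then show ?thesis
          using N zero_le_power2[of N] by linarith
      qed
      also have "\<dots> \<le> r\<^sup>2"
        using N by (intro power_mono) auto
      finally have "(m, n) \<in> digital_disc r"
        using N by (simp add: disc_iff)
      then have "f (n, m, z) \<in> ball_region r"
        using c circle_subset_disc[of m] b N by (auto simp: f_def ball_region_def intro!: exI[of _ m])
      then have "f (n, m, z) \<in> solid_sphere r"
        using ball_region_subset_solid_sphere[of r] N by auto
      moreover have "f (n, m, z) \<notin> hollow_sphere r'" for r'
        using uncovered_not_in_hollow_sphere[OF _ c] b N by (simp add: f_def)
      ultimately show "f p \<in> solid_sphere_absentees r"
        by (simp add: p solid_sphere_absentees_def solid_sphere_union_def)
    qed
    show "finite (solid_sphere_absentees r)"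
      by (rule finite_subset[OF solid_sphere_absentees_subset]) (use N in auto)
  qed
  ultimately show ?thesis
    by linarith
qed

section \<open>The cubic growth rate\<close>

theorem theorem11:
  shows "(\<lambda>r::nat. real (card (solid_sphere_absentees (int r)))) \<in> \<Theta>(\<lambda>r. real r ^ 3)"
proof (rule bigthetaI)
  show "(\<lambda>r::nat. real (card (solid_sphere_absentees (int r)))) \<in> O(\<lambda>r. real r ^ 3)"
  \<comment> \<open>For r >= 1 one has 2 r + 1 <= 3 r, and 27 = 3^3.\<close>
  proof (rule bigoI[of _ 27], rule eventually_at_top_linorderI[of 1])
    fix r :: nat assume r: "1 \<le> r"
    have "int (card (solid_sphere_absentees (int r))) \<le> int ((2 * r + 1) ^ 3)"
      using card_solid_sphere_absentees_le[of "int r"] by (simp add: add.commute)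
    then have "card (solid_sphere_absentees (int r)) \<le> (2 * r + 1) ^ 3"
      by (simp only: of_nat_le_iff)
    also have "\<dots> \<le> (3 * r) ^ 3"
      using r by (intro power_mono) auto
    also have "\<dots> = 27 * r ^ 3"
      by (simp add: power_mult_distrib)
    finally have "real (card (solid_sphere_absentees (int r))) \<le> real (27 * r ^ 3)"
      by (rule of_nat_mono)
    then show "norm (real (card (solid_sphere_absentees (int r)))) \<le> 27 * norm (real r ^ 3)"
      by simp
  qed
  show "(\<lambda>r::nat. real (card (solid_sphere_absentees (int r)))) \<in> \<Omega>(\<lambda>r. real r ^ 3)"
  \<comment> \<open>With N = r div 5 one has r <= 10 N, so r^3 <= 1000 N^3, and N^3 is at most ten
    times the count.\<close>
  proof (rule landau_omega.bigI[of "1 / 10000"])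
    show "\<forall>\<^sub>F r::nat in at_top. 1 / 10000 * norm (real r ^ 3) \<le> norm (real (card (solid_sphere_absentees (int r))))"
    \<comment> \<open>155 is 5 times 31, so that N is at least 31.\<close>
    proof (rule eventually_at_top_linorderI[of 155])
      fix r :: nat assume r: "155 \<le> r"
      define N where "N = int r div 5"
      have N: "31 \<le> N" "5 * N \<le> int r" "int r \<le> 10 * N"
        using r unfolding N_def by linarith+
      have "int r ^ 3 \<le> (10 * N) ^ 3"
        using N(3) by (intro power_mono) auto
      also have "\<dots> \<le> 10000 * int (card (solid_sphere_absentees (int r)))"
        using card_solid_sphere_absentees_ge[OF N(1,2)] by (simp add: power_mult_distrib)
      finally have "real_of_int (int r ^ 3) \<le> real_of_int (10000 * int (card (solid_sphere_absentees (int r))))"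
        by (rule of_int_le_iff[THEN iffD2])
      then show "1 / 10000 * norm (real r ^ 3) \<le> norm (real (card (solid_sphere_absentees (int r))))"
        by simp
    qed
  qed simp
qed

end
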